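(* Let $\mathbb{K}$ be a field and let $I\subset\mathbb{K}[x,y]$ be a (nonzero) monomial ideal which is equigenerated in degree $d$. The following are equivalent: (a) $I$ is integrally closed. (b) $I$ is polymatroidal. (c) $I=(x^iy^{d-i}\mid d_1\le i\le d_2)$ for some integers $d_1,d_2$ with $0\le d_1\le d_2\le d$.
   Context: For a monomial ideal $I$ in $S=\mathbb{K}[x_1,\dots,x_n]$ (here $n=2$, $x_1=x$, $x_2=y$), $G(I)$ denotes the minimal set of monomial generators of $I$. For a monomial $u=x_1^{a_1}\cdots x_n^{a_n}$, $\deg(u)=a_1+\cdots+a_n$ and $\deg_{x_i}(u)=a_i$. The ideal $I$ is equigenerated in degree $d$ if all elements of $G(I)$ have degree $d$. An equigenerated monomial ideal $I$ is polymatroidal if for all $u,v\in G(I)$ and all $i$ with $\deg_{x_i}(u)>\deg_{x_i}(v)$, there exists $j$ with $\deg_{x_j}(u)<\deg_{x_j}(v)$ such that $x_j(u/x_i)\in I$. (For equigenerated monomial ideals this is known to be equivalent to the non-pure dual exchange property: for all $u,v\in G(I)$ with $\deg(u)\le\deg(v)$ and all $i$ with $\deg_{x_i}(v)<\deg_{x_i}(u)$, there exists $j$ with $\deg_{x_j}(v)>\deg_{x_j}(u)$ such that $x_i(v/x_j)\in I$.) An ideal is integrally closed if it equals its integral closure: $z\in S$ is integral over $I$ if there are an integer $s \geq 1$ and $a_k\in I^k$ ($k=1,\dots,s$) with $z^s+a_1z^{s-1}+\cdots+a_{s-1}z+a_s=0$; the integral closure $\overline{I}$ is the set of all elements integral over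 $I$. *)

theory Defs
  imports Complex_Main "HOL-Library.Poly_Mapping"
begin

text \<open>
  The polynomial ring over \<open>'k\<close> with variables \<open>'v\<close> is the monoid ring of the exponent vectors
  \<open>'v \<Rightarrow>\<^sub>0 nat\<close>. A monomial is identified with its exponent vector \<open>u\<close>; as an element of the ring
  it is \<open>monom u\<close>.
\<close>

type_synonym ('v, 'k) mpoly = "('v \<Rightarrow>\<^sub>0 nat) \<Rightarrow>\<^sub>0 'k"

definition monom :: "('v \<Rightarrow>\<^sub>0 nat) \<Rightarrow> ('v, 'k::comm_ring_1) mpoly"
  where "monom u = Poly_Mapping.single u 1"

definition Var :: "'v \<Rightarrow> ('v, 'k::comm_ring_1) mpoly"
  where "Var i = monom (Poly_Mapping.single i 1)"

definition total_deg :: "('v::finite \<Rightarrow>\<^sub>0 nat) \<Rightarrow> nat"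
  where "total_deg u = (\<Sum>i\<in>UNIV. Poly_Mapping.lookup u i)"


text \<open>
  A commutative ring is a module over itself: its ideals are the \<open>ideal.subspace\<close>s, and
  \<open>ideal.span B\<close> is the ideal generated by \<open>B\<close>.
\<close>

global_interpretation ideal: module "(*) :: 'a::comm_ring_1 \<Rightarrow> 'a \<Rightarrow> 'a"
  by unfold_locales (simp_all add: algebra_simps)

fun ideal_power :: "'a::comm_ring_1 set \<Rightarrow> nat \<Rightarrow> 'a set" where
  "ideal_power I 0 = UNIV"
| "ideal_power I (Suc k) = ideal.span {a * b | a b. a \<in> I \<and> b \<in> ideal_power I k}"

definition integral_over :: "'a::comm_ring_1 set \<Rightarrow> 'a \<Rightarrow> bool"
  where "integral_over I z \<longleftrightarrow>
    (\<exists>s\<ge>1. \<exists>a. (\<forall>k\<in>{1..s}. a k \<in> ideal_power I k) \<and> z ^ s + (\<Sum>k=1..s. a k * z ^ (s - k)) = 0)"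

definition integral_closure :: "'a::comm_ring_1 set \<Rightarrow> 'a set"
  where "integral_closure I = {z. integral_over I z}"

definition integrally_closed :: "'a::comm_ring_1 set \<Rightarrow> bool"
  where "integrally_closed I \<longleftrightarrow> I = integral_closure I"


definition monomial_ideal :: "('v, 'k::comm_ring_1) mpoly set \<Rightarrow> bool"
  where "monomial_ideal I \<longleftrightarrow> (\<exists>A. I = ideal.span (monom ` A))"

definition is_min_gens :: "('v, 'k::comm_ring_1) mpoly set \<Rightarrow> ('v \<Rightarrow>\<^sub>0 nat) set \<Rightarrow> bool"
  where "is_min_gens I A \<longleftrightarrow>
    I = ideal.span (monom ` A) \<and> (\<forall>B. B \<subset> A \<longrightarrow> I \<noteq> ideal.span (monom ` B))"

text \<open>
  \<open>min_gens I\<close> is $G(I)$, as a set of exponent vectors. It is well defined for a monomial ideal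
  by \<open>ex1_min_gens\<close> below.
\<close>

definition min_gens :: "('v, 'k::comm_ring_1) mpoly set \<Rightarrow> ('v \<Rightarrow>\<^sub>0 nat) set"
  where "min_gens I = (THE A. is_min_gens I A)"

definition equigenerated :: "nat \<Rightarrow> ('v::finite, 'k::comm_ring_1) mpoly set \<Rightarrow> bool"
  where "equigenerated d I \<longleftrightarrow> (\<forall>u\<in>min_gens I. total_deg u = d)"

text \<open>
  The exponent vector of $x_j (u / x_i)$ is \<open>u - e\<^sub>i + e\<^sub>j\<close>; the truncated subtraction is exact here
  because $x_i$ divides $u$.
\<close>

definition polymatroidal :: "('v::finite, 'k::comm_ring_1) mpoly set \<Rightarrow> bool"
  where "polymatroidal I \<longleftrightarrow>
    monomial_ideal I \<and> (\<exists>d. equigenerated d I) \<and>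
    (\<forall>u\<in>min_gens I. \<forall>v\<in>min_gens I. \<forall>i. Poly_Mapping.lookup u i > Poly_Mapping.lookup v i \<longrightarrow>
      (\<exists>j. Poly_Mapping.lookup u j < Poly_Mapping.lookup v j \<and>
        monom (u - Poly_Mapping.single i 1 + Poly_Mapping.single j 1) \<in> I))"


datatype xy = x | y

instance xy :: finite
proof
  have "(UNIV :: xy set) \<subseteq> {x, y}"
    using xy.exhaust by auto
  then show "finite (UNIV :: xy set)"
    by (rule finite_subset) simp
qed

hide_const (open) x y


lemma monom_mult: "monom u * monom v = (monom (u + v) :: ('v, 'k::comm_ring_1) mpoly)"
  by (simp add: monom_def mult_single)

lemma keys_monom [simp]: "Poly_Mapping.keys (monom u :: ('v, 'k::comm_ring_1) mpoly) = {u}"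
  by (simp add: monom_def)

lemma keys_in_monomial_span:
  assumes "p \<in> ideal.span (monom ` A :: ('v, 'k::comm_ring_1) mpoly set)"
    and "m \<in> Poly_Mapping.keys p"
  shows "\<exists>a\<in>A. \<exists>c. m = a + c"
  using assms
proof (induction arbitrary: m rule: ideal.span_induct_alt)
  case base
  then show ?case by simp
next
  case (step c b q)
  from step.hyps obtain a where a: "a \<in> A" "b = monom a" by blast
  have "m \<in> Poly_Mapping.keys (c * b) \<or> m \<in> Poly_Mapping.keys q"
    using subsetD[OF keys_add step.prems] by simp
  then show ?case
  proof
    assume "m \<in> Poly_Mapping.keys (c * b)"
    from subsetD[OF keys_mult this] obtain e where "m = e + a"
      unfolding a(2) by auto
    then have "m = a + e" by (simp only: add.commute)
    then show ?thesis using a(1) by blast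
  next
    assume "m \<in> Poly_Mapping.keys q"
    then show ?thesis using step.IH by blast
  qed
qed

lemma monom_in_monomial_span_iff:
  "(monom m :: ('v, 'k::comm_ring_1) mpoly) \<in> ideal.span (monom ` A) \<longleftrightarrow> (\<exists>a\<in>A. \<exists>c. m = a + c)"
proof
  assume "(monom m :: ('v, 'k) mpoly) \<in> ideal.span (monom ` A)"
  then show "\<exists>a\<in>A. \<exists>c. m = a + c"
    by (rule keys_in_monomial_span) simp
next
  assume "\<exists>a\<in>A. \<exists>c. m = a + c"
  then obtain a c where a: "a \<in> A" and "m = a + c" by blast
  then have m: "m = c + a" by (simp only: add.commute)
  have "(monom c * monom a :: ('v, 'k) mpoly) \<in> ideal.span (monom ` A)"
    by (rule ideal.span_scale, rule ideal.span_base, rule imageI, rule a)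
  then show "(monom m :: ('v, 'k) mpoly) \<in> ideal.span (monom ` A)"
    by (simp add: monom_mult m)
qed

lemma monomial_span_subset_iff:
  "ideal.span (monom ` A :: ('v, 'k::comm_ring_1) mpoly set) \<subseteq> ideal.span (monom ` B)
    \<longleftrightarrow> (\<forall>a\<in>A. \<exists>b\<in>B. \<exists>c. a = b + c)" (is "?l \<longleftrightarrow> ?r")
proof
  assume l: ?l
  show ?r
  proof
    fix a assume "a \<in> A"
    then have "(monom a :: ('v, 'k) mpoly) \<in> ideal.span (monom ` B)"
      using l ideal.span_base by blast
    then show "\<exists>b\<in>B. \<exists>c. a = b + c" by (simp add: monom_in_monomial_span_iff)
  qed
next
  assume ?r
  then have "(monom ` A :: ('v, 'k) mpoly set) \<subseteq> ideal.span (monom ` B)"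
    using monom_in_monomial_span_iff by blast
  then show ?l by (rule ideal.span_minimal) simp
qed

lemma add_eq_0_exponents: "c = 0" if "b + c = 0" for b c :: "'v \<Rightarrow>\<^sub>0 nat"
proof (rule poly_mapping_eqI)
  fix k
  have "Poly_Mapping.lookup (b + c) k = 0" using that by simp
  then show "Poly_Mapping.lookup c k = Poly_Mapping.lookup 0 k" by (simp add: lookup_add)
qed

lemma is_min_gens_subset:
  assumes "is_min_gens (I :: ('v, 'k::comm_ring_1) mpoly set) A" "is_min_gens I B"
  shows "A \<subseteq> B"
proof
  fix a assume a: "a \<in> A"
  have IA: "I = ideal.span (monom ` A)" and IB: "I = ideal.span (monom ` B)"
    using assms by (auto simp: is_min_gens_def)
  obtain b c where b: "b \<in> B" "a = b + c"
    using monomial_span_subset_iff[where 'k='k, of A B] IA IB a by auto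
  obtain a' c' where a': "a' \<in> A" "b = a' + c'"
    using monomial_span_subset_iff[where 'k='k, of B A] IA IB b by auto
  have "a' = a"
  proof (rule ccontr)
    assume ne: "a' \<noteq> a"
    have "\<exists>e\<in>A - {a}. \<exists>c. g = e + c" if "g \<in> A" for g
    proof (cases "g = a")
      case True
      have "a = a' + (c' + c)" using a'(2) b(2) by (simp add: add.assoc)
      moreover have "a' \<in> A - {a}" using a'(1) ne by simp
      ultimately show ?thesis using True by blast
    next
      case False
      then have "g \<in> A - {a}" "g = g + 0" using that by simp_all
      then show ?thesis by blast
    qed
    then have "I \<subseteq> ideal.span (monom ` (A - {a}))"
      unfolding IA monomial_span_subset_iff by blast
    moreover have "ideal.span (monom ` (A - {a})) \<subseteq> I"
      unfolding IA by (intro ideal.span_mono) auto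
    ultimately have "I = ideal.span (monom ` (A - {a}))" by (rule equalityI)
    moreover have "A - {a} \<subset> A" using a by blast
    ultimately show False using assms(1) unfolding is_min_gens_def by blast
  qed
  then have "a + (c' + c) = a + 0" using b(2) a'(2) by (simp flip: add.assoc)
  then have "c' + c = 0" by (simp only: add_left_cancel)
  then have "c = 0" by (rule add_eq_0_exponents)
  then show "a \<in> B" using b by simp
qed

lemma ex1_min_gens:
  fixes I :: "('v::finite, 'k::comm_ring_1) mpoly set"
  assumes "monomial_ideal I"
  shows "\<exists>!A. is_min_gens I A"
proof -
  obtain A where A: "I = ideal.span (monom ` A)"
    using assms by (auto simp: monomial_ideal_def)
  define M where "M = {a \<in> A. \<forall>b\<in>A. \<forall>c. a = b + c \<longrightarrow> c = 0}"
  have *: "\<exists>b\<in>M. \<exists>c. a = b + c" if "a \<in> A" for a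
    using that
  proof (induction "total_deg a" arbitrary: a rule: less_induct)
    case less
    show ?case
    proof (cases "a \<in> M")
      case True
      then have "a \<in> M" "a = a + 0" by simp_all
      then show ?thesis by blast
    next
      case False
      then obtain b c where bc: "b \<in> A" "a = b + c" "c \<noteq> 0"
        using less.prems by (auto simp: M_def)
      obtain k where "Poly_Mapping.lookup c k \<noteq> 0"
        using bc(3) by (auto simp: poly_mapping_eq_iff fun_eq_iff)
      then have "total_deg c > 0"
        by (auto simp: total_deg_def intro!: sum_pos2[of _ k])
      then have "total_deg b < total_deg a"
        using bc(2) by (simp add: total_deg_def lookup_add sum.distrib)
      then obtain e f where "e \<in> M" "b = e + f" using less.hyps bc(1) by blast
      then have "e \<in> M" "a = e + (f + c)" using bc(2) by (simp_all add: add.assoc)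
      then show ?thesis by blast
    qed
  qed
  have IM: "I = ideal.span (monom ` M)"
  proof (rule equalityI)
    show "I \<subseteq> ideal.span (monom ` M)"
      unfolding A monomial_span_subset_iff using * by blast
    show "ideal.span (monom ` M) \<subseteq> I"
      unfolding A by (intro ideal.span_mono) (auto simp: M_def)
  qed
  have "I \<noteq> ideal.span (monom ` B)" if BM: "B \<subset> M" for B
  proof
    assume "I = ideal.span (monom ` B)"
    then have sub: "\<forall>a\<in>M. \<exists>b\<in>B. \<exists>c. a = b + c"
      using IM monomial_span_subset_iff[where 'k='k, of M B] by auto
    obtain m where m: "m \<in> M" "m \<notin> B" using BM by blast
    then obtain b c where b: "b \<in> B" "m = b + c" using sub by blast
    then have "c = 0" using m(1) BM unfolding M_def by blast
    then show False using b m by simp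
  qed
  then have "is_min_gens I M" using IM by (auto simp: is_min_gens_def)
  then show ?thesis using is_min_gens_subset by (metis subset_antisym)
qed

end

theory Submission
  imports Defs
begin

text \<open>
  Encode $I$ by the set $S$ of all $i$ with $x^i y^{d-i} \in I$; condition (c) says that $S$ is an
  interval. If $I$ is integrally closed and $i \le j \le k$ with $i, k \in S$, then
  $z = x^j y^{d-j}$ satisfies $z^{k-i} = (x^i y^{d-i})^{k-j} (x^k y^{d-k})^{j-i} \in I^{k-i}$, hence
  $j \in S$. If $I$ is polymatroidal, exchanging $x$ for $y$ moves from any element of $S$ down to
  the least one in steps of size 1. Conversely, if $S = [d_1, d_2]$, then $I$ is cut out of the
  polynomial ring by the weight conditions $\deg_x \ge d_1$, $\deg_y \ge d - d_2$, $\deg \ge d$ on all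
  monomials, and such a condition passes from $I$ to all elements integral over $I$ because the
  least weight is multiplicative.
\<close>

section \<open>Weights of integral elements\<close>

text \<open>
  Several exponents of \<open>p\<close> can share the least weight; breaking ties by the monomial order makes the
  coefficient of the least exponent multiplicative.
\<close>

definition least_exponent :: "(('v::linorder \<Rightarrow>\<^sub>0 nat) \<Rightarrow> nat) \<Rightarrow> ('v, 'k::zero) mpoly \<Rightarrow> ('v \<Rightarrow>\<^sub>0 nat) \<Rightarrow> bool"
  where "least_exponent w p m \<longleftrightarrow>
    m \<in> Poly_Mapping.keys p \<and> (\<forall>n\<in>Poly_Mapping.keys p. w m < w n \<or> w m = w n \<and> m \<le> n)"

lemma least_exponent_exists:
  assumes "p \<noteq> 0"
  shows "\<exists>m. least_exponent w p m"
proof -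
  let ?K = "Poly_Mapping.keys p"
  define N where "N = {m \<in> ?K. w m = Min (w ` ?K)}"
  have "?K \<noteq> {}"
    using assms by simp
  then have "Min (w ` ?K) \<in> w ` ?K"
    by (intro Min_in) auto
  then have N: "finite N" "N \<noteq> {}"
    by (auto simp: N_def)
  have "Min N \<in> N"
    by (rule Min_in) (fact N)+
  then have wN: "Min N \<in> ?K" "w (Min N) = Min (w ` ?K)"
    by (simp_all add: N_def)
  have "w (Min N) < w n \<or> w (Min N) = w n \<and> Min N \<le> n" if n: "n \<in> ?K" for n
  proof -
    have "w (Min N) \<le> w n"
      unfolding wN(2) by (rule Min_le) (use n in auto)
    moreover have "Min N \<le> n" if "w (Min N) = w n"
      by (rule Min_le) (use N n wN that in \<open>auto simp: N_def\<close>)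
    ultimately show ?thesis by linarith
  qed
  then show ?thesis
    using wN(1) by (auto simp: least_exponent_def)
qed

text \<open>Addition of exponents is strictly monotone, so the only way to write
  \<open>m + n\<close> with exponents of \<open>p\<close> and \<open>q\<close> is the pair
  \<open>m\<close>, \<open>n\<close>. Its coefficient in \<open>p * q\<close> is then a product of
  two nonzero coefficients, nonzero in a domain.\<close>

lemma least_exponent_mult:
  fixes p q :: "('v::linorder, 'k::idom) mpoly"
  assumes add: "\<And>u v. w (u + v) = w u + w v"
    and p: "least_exponent w p m" and q: "least_exponent w q n"
  shows "least_exponent w (p * q) (m + n)"
proof -
  have ge: "w (m + n) < w (a + b) \<or> w (m + n) = w (a + b) \<and> m + n \<le> a + b"
    and eq: "m + n = a + b \<Longrightarrow> a = m \<and> b = n"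
    if "a \<in> Poly_Mapping.keys p" "b \<in> Poly_Mapping.keys q" for a b
  proof -
    have a: "w m < w a \<or> w m = w a \<and> m \<le> a"
      using p that by (auto simp: least_exponent_def)
    have b: "w n < w b \<or> w n = w b \<and> n \<le> b"
      using q that by (auto simp: least_exponent_def)
    show "w (m + n) < w (a + b) \<or> w (m + n) = w (a + b) \<and> m + n \<le> a + b"
      using a b add_mono[of m a n b] by (auto simp: add)
    assume e: "m + n = a + b"
    then have "w m + w n = w a + w b"
      by (metis add)
    \<comment> \<open>Equal sums of weights exclude a strict inequality in either factor, which
      leaves the tie clause in both.\<close>
    then have "m \<le> a" "n \<le> b"
      using a b by auto
    then show "a = m \<and> b = n"
      using e by (metis add_le_less_mono add_less_le_mono order_less_irrefl order_le_less)
  qed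
  define c d where "c = Poly_Mapping.lookup p m" and "d = Poly_Mapping.lookup q n"
  \<comment> \<open>Splitting off the least terms: only the product of the two removed terms reaches
    the exponent \<open>m + n\<close>.\<close>
  define p' q' where "p' = p - Poly_Mapping.single m c" and "q' = q - Poly_Mapping.single n d"
  have p': "Poly_Mapping.keys p' \<subseteq> Poly_Mapping.keys p - {m}"
    by (auto simp: p'_def c_def in_keys_iff lookup_minus lookup_single when_def split: if_splits)
  have q': "Poly_Mapping.keys q' \<subseteq> Poly_Mapping.keys q - {n}"
    by (auto simp: q'_def d_def in_keys_iff lookup_minus lookup_single when_def split: if_splits)
  have m: "m \<in> Poly_Mapping.keys p" and n: "n \<in> Poly_Mapping.keys q"
    using p q by (auto simp: least_exponent_def)
  have "m + n \<notin> Poly_Mapping.keys (Poly_Mapping.single m c * q')"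
  proof
    assume "m + n \<in> Poly_Mapping.keys (Poly_Mapping.single m c * q')"
    from subsetD[OF keys_mult this] obtain b where "b \<in> Poly_Mapping.keys q'" "m + n = m + b"
      by (auto split: if_splits)
    then show False using q' by auto
  qed
  moreover have "m + n \<notin> Poly_Mapping.keys (p' * q)"
  proof
    assume "m + n \<in> Poly_Mapping.keys (p' * q)"
    from subsetD[OF keys_mult this] obtain a b
      where "a \<in> Poly_Mapping.keys p'" "b \<in> Poly_Mapping.keys q" "m + n = a + b"
      by auto
    then show False using p' eq[of a b] by auto
  qed
  moreover have "p * q = Poly_Mapping.single (m + n) (c * d) + Poly_Mapping.single m c * q' + p' * q"
    by (simp add: p'_def q'_def algebra_simps flip: mult_single)
  ultimately have "Poly_Mapping.lookup (p * q) (m + n) = c * d"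
    by (simp add: lookup_add in_keys_iff)
  then have "m + n \<in> Poly_Mapping.keys (p * q)"
    using m n by (auto simp: c_def d_def in_keys_iff)
  then show ?thesis
    using ge keys_mult[of p q] unfolding least_exponent_def by blast
qed

lemma least_exponent_power:
  fixes p :: "('v::linorder, 'k::idom) mpoly"
  assumes add: "\<And>u v. w (u + v) = w u + w v" and p: "least_exponent w p m"
  shows "\<exists>n. least_exponent w (p ^ s) n \<and> w n = s * w m"
proof (induction s)
  case 0
  have "w 0 = 0"
    using add[of 0 0] by simp
  then show ?case
    by (intro exI[of _ 0]) (simp add: least_exponent_def)
next
  case (Suc s)
  then obtain n where "least_exponent w (p ^ s) n" "w n = s * w m"
    by blast
  then show ?case
    using least_exponent_mult[OF add p] by (intro exI[of _ "m + n"]) (simp add: add)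
qed

text \<open>For additive \<open>w\<close> this is the valuation ideal of the monomial valuation with
  weights \<open>w\<close>; zero lies in it for every \<open>c\<close>, having no exponents.\<close>

definition weight_ge :: "(('v \<Rightarrow>\<^sub>0 nat) \<Rightarrow> nat) \<Rightarrow> nat \<Rightarrow> ('v, 'k::zero) mpoly set"
  where "weight_ge w c = {p. \<forall>m\<in>Poly_Mapping.keys p. c \<le> w m}"

lemma weight_ge_mult:
  fixes p q :: "('v, 'k::comm_ring_1) mpoly"
  assumes "\<And>u v. w (u + v) = w u + w v" "p \<in> weight_ge w a" "q \<in> weight_ge w b"
  shows "p * q \<in> weight_ge w (a + b)"
  using assms keys_mult[of p q] by (fastforce simp: weight_ge_def intro: add_mono)

lemma weight_ge_0 [simp]: "p \<in> weight_ge w 0"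
  by (simp add: weight_ge_def)

lemma subspace_weight_ge:
  assumes "\<And>u v. w (u + v) = w u + w v"
  shows "ideal.subspace (weight_ge w c :: ('v, 'k::comm_ring_1) mpoly set)"
proof (rule ideal.subspaceI)
  fix p q :: "('v, 'k) mpoly"
  assume "p \<in> weight_ge w c"
  then show "p + q \<in> weight_ge w c" if "q \<in> weight_ge w c"
    using keys_add[of p q] that by (auto simp: weight_ge_def)
  show "q * p \<in> weight_ge w c"
    using weight_ge_mult[OF assms weight_ge_0 \<open>p \<in> weight_ge w c\<close>] by simp
qed (simp add: weight_ge_def)

text \<open>The right-hand side is an ideal containing all products that generate the power on the
  left; for \<open>k = 0\<close> both sides are the whole ring.\<close>

lemma ideal_power_weight_ge:
  fixes I :: "('v, 'k::comm_ring_1) mpoly set"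
  assumes add: "\<And>u v. w (u + v) = w u + w v" and I: "I \<subseteq> weight_ge w c"
  shows "ideal_power I k \<subseteq> weight_ge w (k * c)"
proof (induction k)
  case (Suc k)
  show ?case
    unfolding ideal_power.simps
    by (rule ideal.span_minimal[OF _ subspace_weight_ge[of w, OF add]])
      (use I Suc weight_ge_mult[of w _ c _ "k * c", OF add] in auto)
qed auto

text \<open>
  If the weight of \<open>z\<close> were some \<open>e < c\<close>, then \<open>z ^ s\<close> would have weight \<open>s * e\<close>, while every
  \<open>a k * z ^ (s - k)\<close> has weight at least \<open>k * c + (s - k) * e > s * e\<close>.
\<close>

lemma integral_over_weight_ge:
  fixes I :: "('v::linorder, 'k::idom) mpoly set"
  assumes add: "\<And>u v. w (u + v) = w u + w v" and I: "I \<subseteq> weight_ge w c"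
    and z: "integral_over I z"
  shows "z \<in> weight_ge w c"
proof (rule ccontr)
  assume nz: "z \<notin> weight_ge w c"
  then have "z \<noteq> 0"
    by (auto simp: weight_ge_def)
  then obtain m where m: "least_exponent w z m"
    using least_exponent_exists by blast
  define e where "e = w m"
  have zm: "z \<in> weight_ge w e"
    using m by (auto simp: weight_ge_def least_exponent_def e_def)
  have "e < c"
    using nz m by (force simp: weight_ge_def least_exponent_def e_def)
  obtain s a where s: "s \<ge> 1" and a: "\<forall>k\<in>{1..s}. a k \<in> ideal_power I k"
    and 0: "z ^ s + (\<Sum>k=1..s. a k * z ^ (s - k)) = 0"
    using z by (auto simp: integral_over_def)
  have "z ^ n \<in> weight_ge w (n * e)" for n
    by (induction n) (auto intro: weight_ge_mult[of w, OF add zm])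
  \<comment> \<open>\<open>Suc\<close> encodes the strict bound; it is strict because every index
    \<open>k\<close> of the sum is at least 1.\<close>
  have "a k * z ^ (s - k) \<in> weight_ge w (Suc (s * e))" if k: "k \<in> {1..s}" for k
  proof -
    have "a k * z ^ (s - k) \<in> weight_ge w (k * c + (s - k) * e)"
      by (rule weight_ge_mult[of w, OF add])
        (use a k ideal_power_weight_ge[of w, OF add I, of k] \<open>z ^ (s - k) \<in> _\<close> in auto)
    moreover have "s * e < k * c + (s - k) * e"
    proof -
      have "s * e = k * e + (s - k) * e"
        using k by (simp flip: add_mult_distrib)
      also have "\<dots> < k * c + (s - k) * e"
        using k \<open>e < c\<close> by simp
      finally show ?thesis .
    qed
    ultimately show ?thesis
      by (fastforce simp: weight_ge_def)
  qed
  then have "(\<Sum>k=1..s. a k * z ^ (s - k)) \<in> weight_ge w (Suc (s * e))"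
    by (rule ideal.subspace_sum[OF subspace_weight_ge[of w, OF add]])
  then have "- (\<Sum>k=1..s. a k * z ^ (s - k)) \<in> weight_ge w (Suc (s * e))"
    by (rule ideal.subspace_neg[OF subspace_weight_ge[of w, OF add]])
  moreover have "z ^ s = - (\<Sum>k=1..s. a k * z ^ (s - k))"
    using 0 by (simp add: eq_neg_iff_add_eq_0)
  ultimately have "z ^ s \<in> weight_ge w (Suc (s * e))"
    by simp
  moreover obtain n where "n \<in> Poly_Mapping.keys (z ^ s)" "w n = s * e"
    using least_exponent_power[OF add m, of s] by (auto simp: least_exponent_def e_def)
  ultimately show False
    by (auto simp: weight_ge_def)
qed


section \<open>Powers of ideals and monomial ideals\<close>

lemma ideal_power_subspace: "ideal.subspace (ideal_power I k)"
  by (cases k) simp_all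

text \<open>Factors from \<open>I\<close> are multiplied on one at a time. Starting from 1 in
  \<open>ideal_power I 0\<close> and applying this twice places products of two powers.\<close>

lemma power_mult_in_ideal_power:
  assumes "p \<in> I" "q \<in> ideal_power I n"
  shows "p ^ a * q \<in> ideal_power I (a + n)"
proof (induction a)
  case (Suc a)
  then have "p * (p ^ a * q) \<in> ideal_power I (Suc (a + n))"
    unfolding ideal_power.simps using assms(1) by (intro ideal.span_base) blast
  then show ?case by (simp only: power_Suc mult.assoc add_Suc)
qed (use assms in simp)

text \<open>The equation is \<open>Z^n - z^n = 0\<close> in the unknown \<open>Z\<close>: its only
  nonleading coefficient is the constant one, which lies in the \<open>n\<close>-th power of
  \<open>I\<close>.\<close>

lemma integral_over_if_power:
  assumes "z ^ n \<in> ideal_power I n" "n \<ge> 1"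
  shows "integral_over I z"
  unfolding integral_over_def
proof (intro exI conjI ballI)
  let ?a = "\<lambda>k. if k = n then - (z ^ n) else 0"
  show "?a k \<in> ideal_power I k" for k
    using assms by (auto intro: ideal.subspace_neg ideal.subspace_0 ideal_power_subspace)
  have "(\<Sum>k=1..n. ?a k * z ^ (n - k)) = (\<Sum>k=1..n. if k = n then - (z ^ n) else 0)"
    by (intro sum.cong) auto
  also have "\<dots> = - (z ^ n)"
    using assms(2) by simp
  finally show "z ^ n + (\<Sum>k=1..n. ?a k * z ^ (n - k)) = 0"
    by simp
qed (fact assms)

lemma subset_integral_closure: "I \<subseteq> integral_closure I"
proof
  fix z assume "z \<in> I"
  then have "z ^ 1 * 1 \<in> ideal_power I (1 + 0)"
    by (rule power_mult_in_ideal_power) simp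
  then have "z ^ 1 \<in> ideal_power I 1"
    by (simp only: mult_1_right add_0_right)
  then have "integral_over I z"
    by (rule integral_over_if_power) (rule order_refl)
  then show "z \<in> integral_closure I"
    unfolding integral_closure_def by (rule CollectI)
qed

lemma monom_power_mult:
  "monom u ^ a * monom v ^ b = (monom t :: ('v, 'k::comm_ring_1) mpoly)"
  if "\<And>i. Poly_Mapping.lookup t i = a * Poly_Mapping.lookup u i + b * Poly_Mapping.lookup v i"
proof -
  have power: "\<exists>t'. monom u ^ a = (monom t' :: ('v, 'k) mpoly) \<and>
    (\<forall>i. Poly_Mapping.lookup t' i = a * Poly_Mapping.lookup u i)" for u :: "'v \<Rightarrow>\<^sub>0 nat" and a
  proof (induction a)
    case 0
    show ?case by (intro exI[of _ 0]) (simp add: monom_def)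
  next
    case (Suc a)
    then obtain t' where "monom u ^ a = (monom t' :: ('v, 'k) mpoly)"
      "\<forall>i. Poly_Mapping.lookup t' i = a * Poly_Mapping.lookup u i" by blast
    then show ?case by (intro exI[of _ "u + t'"]) (simp add: monom_mult lookup_add)
  qed
  obtain u' v' where
    "monom u ^ a = (monom u' :: ('v, 'k) mpoly)" "\<forall>i. Poly_Mapping.lookup u' i = a * Poly_Mapping.lookup u i"
    "monom v ^ b = (monom v' :: ('v, 'k) mpoly)" "\<forall>i. Poly_Mapping.lookup v' i = b * Poly_Mapping.lookup v i"
    using power[of u a] power[of v b] by blast
  moreover from this have "u' + v' = t"
    using that by (intro poly_mapping_eqI) (simp add: lookup_add)
  ultimately show ?thesis
    by (simp add: monom_mult)
qed

text \<open>A polynomial is the combination of its own monomials whose scalars are its coefficients,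
  read as constant polynomials.\<close>

lemma in_ideal_if_monoms_in:
  fixes p :: "('v, 'k::comm_ring_1) mpoly"
  assumes I: "ideal.subspace I" and "\<And>m. m \<in> Poly_Mapping.keys p \<Longrightarrow> monom m \<in> I"
  shows "p \<in> I"
proof -
  have "p = (\<Sum>m\<in>Poly_Mapping.keys p. Poly_Mapping.single m (Poly_Mapping.lookup p m))"
    by (rule poly_mapping_eqI)
      (auto simp: lookup_sum lookup_single when_def in_keys_iff)
  also have "\<dots> = (\<Sum>m\<in>Poly_Mapping.keys p. Poly_Mapping.single 0 (Poly_Mapping.lookup p m) * monom m)"
    by (simp add: monom_def mult_single)
  also have "\<dots> \<in> I"
    using assms by (intro ideal.subspace_sum ideal.subspace_scale)
  finally show ?thesis .
qed

lemma total_deg_add: "total_deg (u + v) = total_deg u + total_deg v"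
  by (simp add: total_deg_def lookup_add sum.distrib)

lemma total_deg_eq_0_iff: "total_deg u = 0 \<longleftrightarrow> u = 0"
  by (auto simp: total_deg_def poly_mapping_eq_iff fun_eq_iff)

lemma span_min_gens:
  fixes I :: "('v::finite, 'k::comm_ring_1) mpoly set"
  assumes "monomial_ideal I"
  shows "I = ideal.span (monom ` min_gens I)"
proof -
  have "is_min_gens I (min_gens I)"
    unfolding min_gens_def by (rule theI') (rule ex1_min_gens[OF assms])
  then show ?thesis
    unfolding is_min_gens_def by (rule conjunct1)
qed

text \<open>A generator dividing \<open>u\<close> has the same degree \<open>d\<close> as
  \<open>u\<close>, so the cofactor has degree 0 and \<open>u\<close> is that generator.\<close>

lemma in_min_gens_iff:
  fixes I :: "('v::finite, 'k::comm_ring_1) mpoly set"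
  assumes "monomial_ideal I" "equigenerated d I"
  shows "u \<in> min_gens I \<longleftrightarrow> monom u \<in> I \<and> total_deg u = d"
proof
  assume u: "u \<in> min_gens I"
  then have "monom u \<in> ideal.span (monom ` min_gens I :: ('v, 'k) mpoly set)"
    by (intro ideal.span_base imageI)
  then show "monom u \<in> I \<and> total_deg u = d"
    using u assms(2) by (simp add: equigenerated_def flip: span_min_gens[OF assms(1)])
next
  assume u: "monom u \<in> I \<and> total_deg u = d"
  then have "monom u \<in> ideal.span (monom ` min_gens I :: ('v, 'k) mpoly set)"
    by (simp flip: span_min_gens[OF assms(1)])
  then obtain g c where g: "g \<in> min_gens I" "u = g + c"
    unfolding monom_in_monomial_span_iff by blast
  then have "total_deg c = 0"
    using u assms(2) by (auto simp: equigenerated_def total_deg_add)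
  then have "c = 0"
    by (simp only: total_deg_eq_0_iff)
  then show "u \<in> min_gens I"
    using g by simp
qed


section \<open>Two variables\<close>

text \<open>An order on the variables induces the order on exponent vectors that breaks ties in
  \<open>least_exponent\<close>; here \<open>x\<close> precedes \<open>y\<close>.\<close>

instantiation xy :: linorder
begin

definition less_eq_xy :: "xy \<Rightarrow> xy \<Rightarrow> bool"
  where "less_eq_xy a b \<longleftrightarrow> a = xy.x \<or> b = xy.y"

definition less_xy :: "xy \<Rightarrow> xy \<Rightarrow> bool"
  where "less_xy a b \<longleftrightarrow> a = xy.x \<and> b = xy.y"

instance
proof
  fix a b c :: xy
  show "a < b \<longleftrightarrow> a \<le> b \<and> \<not> b \<le> a"
    by (cases a; cases b) (simp_all add: less_eq_xy_def less_xy_def)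
  show "a \<le> a"
    by (cases a) (simp_all add: less_eq_xy_def)
  show "a \<le> b \<Longrightarrow> b \<le> c \<Longrightarrow> a \<le> c"
    by (auto simp: less_eq_xy_def)
  show "a \<le> b \<Longrightarrow> b \<le> a \<Longrightarrow> a = b"
    by (auto simp: less_eq_xy_def)
  show "a \<le> b \<or> b \<le> a"
    by (cases a) (simp_all add: less_eq_xy_def)
qed

end

definition xy_exp :: "nat \<Rightarrow> nat \<Rightarrow> xy \<Rightarrow>\<^sub>0 nat"
  where "xy_exp i j = Poly_Mapping.single xy.x i + Poly_Mapping.single xy.y j"

lemma lookup_xy_exp [simp]:
  "Poly_Mapping.lookup (xy_exp i j) xy.x = i" "Poly_Mapping.lookup (xy_exp i j) xy.y = j"
  by (simp_all add: xy_exp_def lookup_add lookup_single)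

lemma xy_eq_iff:
  "u = v \<longleftrightarrow> Poly_Mapping.lookup u xy.x = Poly_Mapping.lookup v xy.x \<and>
    Poly_Mapping.lookup u xy.y = Poly_Mapping.lookup v xy.y"
  (is "_ \<longleftrightarrow> ?r")
proof
  assume r: ?r
  show "u = v"
  proof (rule poly_mapping_eqI)
    fix i
    show "Poly_Mapping.lookup u i = Poly_Mapping.lookup v i"
      using r by (cases i) simp_all
  qed
qed simp

lemma total_deg_xy: "total_deg u = Poly_Mapping.lookup u xy.x + Poly_Mapping.lookup u xy.y"
proof -
  have UNIV_xy: "(UNIV :: xy set) = {xy.x, xy.y}"
    using xy.exhaust by auto
  show ?thesis
    by (simp add: total_deg_def UNIV_xy)
qed

lemma Var_powers: "Var xy.x ^ i * Var xy.y ^ j = (monom (xy_exp i j) :: (xy, 'k::comm_ring_1) mpoly)"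
  unfolding Var_def
proof (rule monom_power_mult)
  fix v
  show "Poly_Mapping.lookup (xy_exp i j) v = i * Poly_Mapping.lookup (Poly_Mapping.single xy.x 1) v
    + j * Poly_Mapping.lookup (Poly_Mapping.single xy.y 1) v"
    by (cases v) (simp_all add: lookup_single)
qed

section \<open>The ideals of condition (c)\<close>

definition strip_ideal :: "nat \<Rightarrow> nat \<Rightarrow> nat \<Rightarrow> (xy, 'k::comm_ring_1) mpoly set"
  where "strip_ideal d d1 d2 = ideal.span (monom ` (\<lambda>i. xy_exp i (d - i)) ` {d1..d2})"

lemma strip_ideal_eq:
  "ideal.span {Var xy.x ^ i * Var xy.y ^ (d - i) | i. d1 \<le> i \<and> i \<le> d2} =
    (strip_ideal d d1 d2 :: (xy, 'k::comm_ring_1) mpoly set)"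
  unfolding strip_ideal_def Var_powers by (rule arg_cong[where f = ideal.span]) auto

lemma monom_in_strip_ideal_iff:
  assumes "d1 \<le> d2" "d2 \<le> d"
  shows "(monom u :: (xy, 'k::comm_ring_1) mpoly) \<in> strip_ideal d d1 d2 \<longleftrightarrow>
    d1 \<le> Poly_Mapping.lookup u xy.x \<and> d - d2 \<le> Poly_Mapping.lookup u xy.y \<and> d \<le> total_deg u"
    (is "?l \<longleftrightarrow> ?r")
proof
  assume ?l
  then show ?r
    using assms by (auto simp: strip_ideal_def monom_in_monomial_span_iff total_deg_xy lookup_add)
next
  assume r: ?r
  \<comment> \<open>The largest admissible power of \<open>x\<close> leaves the smallest power of
    \<open>y\<close> to divide out. If \<open>i\<close> is the \<open>x\<close>-degree of
    \<open>u\<close>, the bound on the total degree suffices for \<open>y\<close>; if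
    \<open>i = d2\<close>, the bound on the \<open>y\<close>-degree does.\<close>
  define i where "i = min (Poly_Mapping.lookup u xy.x) d2"
  have i: "i \<in> {d1..d2}"
    using r assms by (auto simp: i_def)
  have "u = xy_exp i (d - i) + xy_exp (Poly_Mapping.lookup u xy.x - i) (Poly_Mapping.lookup u xy.y - (d - i))"
    using r assms by (auto simp: xy_eq_iff lookup_add total_deg_xy i_def)
  then show ?l
    unfolding strip_ideal_def monom_in_monomial_span_iff using i by blast
qed

lemma strip_ideal_integrally_closed:
  assumes "d1 \<le> d2" "d2 \<le> d"
  shows "integrally_closed (strip_ideal d d1 d2 :: (xy, 'k::idom) mpoly set)"
    (is "integrally_closed ?I")
proof -
  have sub: "ideal.subspace ?I"
    by (simp add: strip_ideal_def)
  have gens: "d1 \<le> Poly_Mapping.lookup m xy.x" "d - d2 \<le> Poly_Mapping.lookup m xy.y" "d \<le> total_deg m"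
    if p: "p \<in> ?I" and m: "m \<in> Poly_Mapping.keys p" for p m
  proof -
    \<comment> \<open>Every monomial of a member of a monomial ideal is itself a member, so the
      criterion for monomials applies.\<close>
    have "(monom m :: (xy, 'k) mpoly) \<in> ?I"
      using keys_in_monomial_span[OF p[unfolded strip_ideal_def] m]
      unfolding strip_ideal_def monom_in_monomial_span_iff .
    then show "d1 \<le> Poly_Mapping.lookup m xy.x" "d - d2 \<le> Poly_Mapping.lookup m xy.y" "d \<le> total_deg m"
      using monom_in_strip_ideal_iff[OF assms] by auto
  qed
  have "z \<in> ?I" if z: "integral_over ?I z" for z
  proof (rule in_ideal_if_monoms_in[OF sub])
    fix m assume m: "m \<in> Poly_Mapping.keys z"
    have "z \<in> weight_ge (\<lambda>u. Poly_Mapping.lookup u xy.x) d1"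
      by (rule integral_over_weight_ge[OF _ _ z]) (auto simp: lookup_add weight_ge_def gens)
    moreover have "z \<in> weight_ge (\<lambda>u. Poly_Mapping.lookup u xy.y) (d - d2)"
      by (rule integral_over_weight_ge[OF _ _ z]) (use gens in \<open>auto simp: lookup_add weight_ge_def\<close>)
    moreover have "z \<in> weight_ge total_deg d"
      by (rule integral_over_weight_ge[OF _ _ z]) (auto simp: total_deg_add weight_ge_def gens)
    ultimately show "monom m \<in> ?I"
      using m by (simp add: weight_ge_def monom_in_strip_ideal_iff[OF assms])
  qed
  then show ?thesis
    using subset_integral_closure[of ?I] by (auto simp: integrally_closed_def integral_closure_def)
qed

text \<open>Since \<open>u\<close> and \<open>v\<close> have equal degree, an excess of
  \<open>u\<close> in one variable is a deficit in the other. The exchange moves \<open>u\<close>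
  one step towards \<open>v\<close>, so it stays within the bounds that both satisfy.\<close>

lemma strip_ideal_polymatroidal:
  fixes I :: "(xy, 'k::comm_ring_1) mpoly set"
  assumes I: "monomial_ideal I" "equigenerated d I"
    and d: "d1 \<le> d2" "d2 \<le> d" and eq: "I = strip_ideal d d1 d2"
  shows "polymatroidal I"
proof -
  have "\<exists>j. Poly_Mapping.lookup u j < Poly_Mapping.lookup v j \<and>
      monom (u - Poly_Mapping.single i 1 + Poly_Mapping.single j 1) \<in> I"
    if "u \<in> min_gens I" "v \<in> min_gens I" and i: "Poly_Mapping.lookup v i < Poly_Mapping.lookup u i"
    for u v i
  proof -
    note uv = that(1,2)[unfolded in_min_gens_iff[OF I]]
    note * = uv[unfolded eq monom_in_strip_ideal_iff[OF d], unfolded total_deg_xy]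
    show ?thesis
    proof (cases i)
      case x
      then show ?thesis
        using * i by (intro exI[of _ xy.y])
          (auto simp: eq monom_in_strip_ideal_iff[OF d] total_deg_xy lookup_add lookup_minus lookup_single)
    next
      case y
      then show ?thesis
        using * i by (intro exI[of _ xy.x])
          (auto simp: eq monom_in_strip_ideal_iff[OF d] total_deg_xy lookup_add lookup_minus lookup_single)
    qed
  qed
  then show ?thesis
    using I unfolding polymatroidal_def by blast
qed

section \<open>Convexity of the set of \<open>x\<close>-exponents\<close>

text \<open>The common route from (a) and from (b) to (c): a nonempty finite convex set of naturals
  is the interval from its minimum to its maximum.\<close>

lemma strip_ideal_if_convex:
  fixes I :: "(xy, 'k::comm_ring_1) mpoly set"
  assumes I: "monomial_ideal I" "equigenerated d I" "I \<noteq> {0}"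
    and convex: "\<And>i j k. \<lbrakk>i \<le> j; j \<le> k; k \<le> d; monom (xy_exp i (d - i)) \<in> I;
      monom (xy_exp k (d - k)) \<in> I\<rbrakk> \<Longrightarrow> monom (xy_exp j (d - j)) \<in> I"
  shows "\<exists>d1 d2. d1 \<le> d2 \<and> d2 \<le> d \<and> I = strip_ideal d d1 d2"
proof -
  define S where "S = {i. i \<le> d \<and> monom (xy_exp i (d - i)) \<in> I}"
  have "finite S"
    by (rule finite_subset[of _ "{..d}"]) (auto simp: S_def)
  have gens: "min_gens I = (\<lambda>i. xy_exp i (d - i)) ` S"
  proof (intro set_eqI iffI)
    fix u assume "u \<in> min_gens I"
    then have u: "monom u \<in> I" "total_deg u = d"
      using in_min_gens_iff[OF I(1,2)] by auto
    then have "u = xy_exp (Poly_Mapping.lookup u xy.x) (d - Poly_Mapping.lookup u xy.x)"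
      by (auto simp: xy_eq_iff total_deg_xy)
    moreover from this have "Poly_Mapping.lookup u xy.x \<in> S"
      using u by (auto simp: S_def total_deg_xy)
    ultimately show "u \<in> (\<lambda>i. xy_exp i (d - i)) ` S"
      by blast
  next
    fix u assume "u \<in> (\<lambda>i. xy_exp i (d - i)) ` S"
    then show "u \<in> min_gens I"
      by (auto simp: in_min_gens_iff[OF I(1,2)] S_def total_deg_xy)
  qed
  have span: "ideal.span (monom ` (\<lambda>i. xy_exp i (d - i)) ` S) = I"
    unfolding gens[symmetric] by (rule span_min_gens[OF I(1), symmetric])
  \<comment> \<open>The empty set would span the zero ideal.\<close>
  then have "S \<noteq> {}"
    using I(3) by auto
  have Min_Max: "Min S \<in> S" "Max S \<in> S"
    using \<open>finite S\<close> \<open>S \<noteq> {}\<close> by simp_all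
  have "{Min S..Max S} = S"
  proof (rule equalityI)
    show "S \<subseteq> {Min S..Max S}"
      using \<open>finite S\<close> by auto
    show "{Min S..Max S} \<subseteq> S"
    proof
      fix j assume "j \<in> {Min S..Max S}"
      then show "j \<in> S"
        using convex[of "Min S" j "Max S"] Min_Max unfolding S_def by simp
    qed
  qed
  then have "I = strip_ideal d (Min S) (Max S)"
    by (simp only: strip_ideal_def span)
  moreover have "Min S \<le> Max S"
    using \<open>finite S\<close> Min_Max by (intro Min_le)
  moreover have "Max S \<le> d"
    using Min_Max(2) unfolding S_def by simp
  ultimately show ?thesis
    by blast
qed

lemma integrally_closed_convex:
  fixes I :: "(xy, 'k::comm_ring_1) mpoly set"
  assumes I: "integrally_closed I" and ijk: "i \<le> j" "j \<le> k" "k \<le> d"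
    and i: "monom (xy_exp i (d - i)) \<in> I" and k: "monom (xy_exp k (d - k)) \<in> I"
  shows "monom (xy_exp j (d - j)) \<in> I"
proof (cases "i = k")
  case False
  \<comment> \<open>The common exponent of both sides of the power identity; in the
    \<open>x\<close>-coordinate, \<open>(k - i) * j = (k - j) * i + (j - i) * k\<close>.\<close>
  define t where "t = xy_exp ((k - i) * j) ((k - i) * (d - j))"
  let ?z = "monom (xy_exp j (d - j)) :: (xy, 'k) mpoly"
  \<comment> \<open>The factor \<open>monom 0 ^ 0\<close> is a dummy that gives a single power the
    shape of \<open>monom_power_mult\<close>.\<close>
  have "?z ^ (k - i) * monom 0 ^ 0 = monom t"
    by (rule monom_power_mult) (metis (full_types) lookup_xy_exp t_def mult_0 add_0_right xy.exhaust)
  moreover have "monom (xy_exp i (d - i)) ^ (k - j) * monom (xy_exp k (d - k)) ^ (j - i)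
    = (monom t :: (xy, 'k) mpoly)"
  proof (rule monom_power_mult)
    \<comment> \<open>Writing the numbers by their gaps turns every truncated subtraction into an
      exact one.\<close>
    obtain a b c where abc: "j = i + a" "k = i + a + b" "d = i + a + b + c"
      using ijk by (metis le_Suc_ex)
    show "Poly_Mapping.lookup t v = (k - j) * Poly_Mapping.lookup (xy_exp i (d - i)) v
      + (j - i) * Poly_Mapping.lookup (xy_exp k (d - k)) v" for v
      by (cases v) (simp_all add: t_def abc algebra_simps)
  qed
  moreover have "monom (xy_exp i (d - i)) ^ (k - j) * (monom (xy_exp k (d - k)) ^ (j - i) * 1)
    \<in> ideal_power I (k - j + (j - i + 0))"
    using i k by (intro power_mult_in_ideal_power) simp_all
  ultimately have "?z ^ (k - i) \<in> ideal_power I (k - i)"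
    using ijk by simp
  then have "integral_over I ?z"
    by (rule integral_over_if_power) (use False ijk in simp)
  then show ?thesis
    using I by (auto simp: integrally_closed_def integral_closure_def)
qed (use ijk i in simp)

lemma polymatroidal_convex:
  fixes I :: "(xy, 'k::comm_ring_1) mpoly set"
  assumes I: "polymatroidal I" "equigenerated d I" and "i \<le> j" "j \<le> k" "k \<le> d"
    and i: "monom (xy_exp i (d - i)) \<in> I" and k: "monom (xy_exp k (d - k)) \<in> I"
  shows "monom (xy_exp j (d - j)) \<in> I"
  using \<open>j \<le> k\<close> \<open>i \<le> j\<close>
\<comment> \<open>Descent from \<open>k\<close> to \<open>j\<close>, exchanging each time against
  the fixed generator with \<open>x\<close>-exponent \<open>i\<close>.\<close>
proof (induction rule: inc_induct)
  case (step n)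
  let ?u = "xy_exp (Suc n) (d - Suc n)" and ?v = "xy_exp i (d - i)"
  have n: "Suc n \<le> d" "i \<le> n"
    using step \<open>k \<le> d\<close> by auto
  have "monomial_ideal I"
    using I by (simp add: polymatroidal_def)
  note gens = in_min_gens_iff[OF this I(2)]
  have "?u \<in> min_gens I" "?v \<in> min_gens I"
    using step i n by (simp_all add: gens total_deg_xy)
  moreover have "Poly_Mapping.lookup ?v xy.x < Poly_Mapping.lookup ?u xy.x"
    using n by simp
  ultimately obtain v where v: "Poly_Mapping.lookup ?u v < Poly_Mapping.lookup ?v v"
    "monom (?u - Poly_Mapping.single xy.x 1 + Poly_Mapping.single v 1) \<in> I"
    using I(1) unfolding polymatroidal_def by blast
  \<comment> \<open>\<open>?u\<close> has the larger \<open>x\<close>-exponent, so only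
    \<open>y\<close> can be raised.\<close>
  moreover have "v = xy.y"
    using v(1) n by (cases v) auto
  moreover have "?u - Poly_Mapping.single xy.x 1 + Poly_Mapping.single xy.y 1 = xy_exp n (d - n)"
    using n by (simp add: xy_eq_iff lookup_add lookup_minus lookup_single)
  ultimately show ?case
    by simp
qed (use k in simp)

theorem theorem2p9:
  fixes I :: "(xy, 'k::field) mpoly set" and d :: nat
  assumes "monomial_ideal I" and "I \<noteq> {0}" and "equigenerated d I"
  shows "(integrally_closed I \<longleftrightarrow> polymatroidal I) \<and>
    (polymatroidal I \<longleftrightarrow>
      (\<exists>d1 d2. d1 \<le> d2 \<and> d2 \<le> d \<and>
        I = ideal.span {Var xy.x ^ i * Var xy.y ^ (d - i) | i. d1 \<le> i \<and> i \<le> d2}))"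
proof -
  let ?c = "\<exists>d1 d2. d1 \<le> d2 \<and> d2 \<le> d \<and> I = strip_ideal d d1 d2"
  have "?c" if "integrally_closed I"
    using strip_ideal_if_convex[OF assms(1,3,2)] integrally_closed_convex[OF that] by blast
  moreover have "?c" if "polymatroidal I"
    using strip_ideal_if_convex[OF assms(1,3,2)] polymatroidal_convex[OF that assms(3)] by blast
  moreover have "integrally_closed I" "polymatroidal I" if ?c
    using that strip_ideal_integrally_closed strip_ideal_polymatroidal[OF assms(1,3)] by blast+
  ultimately show ?thesis
    unfolding strip_ideal_eq by blast
qed

end
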